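(* Let $\alpha\in(0,1)$. Then the iteration $\tilde{X}_{q+1}=\mathscr{H}(\tilde{X}_q)$, $q=0,1,\ldots$, converges to the unique fixed point (of $\mathscr{H}$) in $\mathbb{R}_+^{n\times n}$ for an arbitrary initial point $\tilde{X}_0\in\mathbb{R}_+^{n\times n}$.
   Context: $\mathbb{R}_+^{n}$ and $\mathbb{R}_+^{n\times n}$ denote entrywise nonnegative vectors and matrices; $e\in\mathbb{R}^n$ is the all-ones vector; $A(:,j)$ and $A(j,:)$ are the $j$-th column and $j$-th row of $A$. $\mathcal{P}$ is an order-3, $n$-dimensional transition tensor, i.e. $\mathcal{P}_{ijk}\ge 0$ and $\sum_i\mathcal{P}_{ijk}=1$ for all $j,k$. For $j=1,\ldots,n$, $P_j\in\mathbb{R}^{n\times n}$ is the column stochastic matrix with entries $(P_j)_{ik}=\mathcal{P}_{ijk}$. $v\in\mathbb{R}^n$ is a stochastic vector (nonnegative, entries summing to 1) and $G=\frac1n v e^T\in\mathbb{R}^{n\times n}$. $\beta>0$ is a fixed number. Operators: - $\mathscr{P}:\mathbb{R}^{n\times n}\to\mathbb{R}^{n\times n}$, $\mathscr{P}(A)(:,j)=P_jA(j,:)^T$ for $j=1,\ldots,n$. - $\mathscr{T}:\mathbb{R}_+^n\to\mathbb{R}_+^n$, $\mathscr{T}(b)=s^*+e\mu^*$, where $(s^*,\mu^* )$ is the (known to be unique) minimizer of $\frac12\|s+e\mu-b\|_2^2+\beta\|s\|_1$ over $s\in\mathbb{R}^n$, $\mu\in\mathbb{R}$ subject to $s\ge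 0$, $\mu\ge 0$. - $\tilde{\mathscr{T}}:\mathbb{R}_+^{n\times n}\to\mathbb{R}_+^{n\times n}$, $\tilde{\mathscr{T}}(A)=[\mathscr{T}(A(:,1)),\ldots,\mathscr{T}(A(:,n))]$. - $\mathscr{G}(A)(:,j)=\alpha\,\mathscr{P}(A)(:,j)+(1-\alpha)G(:,j)$ for $j=1,\ldots,n$. - $\mathscr{H}:\mathbb{R}_+^{n\times n}\to\mathbb{R}_+^{n\times n}$, $\mathscr{H}(A)=\tilde{\mathscr{T}}(\mathscr{G}(A))$. *)

theory Defs
  imports "HOL-Analysis.Analysis"
begin

definition ones :: "real ^ 'n" where
  "ones = (\<chi> i. 1)"

definition nonneg_vec :: "real ^ 'n \<Rightarrow> bool" where
  "nonneg_vec x \<longleftrightarrow> (\<forall>i. 0 \<le> x $ i)"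

definition nonneg_mat :: "real ^ 'n ^ 'n \<Rightarrow> bool" where
  "nonneg_mat A \<longleftrightarrow> (\<forall>i j. 0 \<le> A $ i $ j)"

definition stochastic_vec :: "real ^ 'n \<Rightarrow> bool" where
  "stochastic_vec v \<longleftrightarrow> nonneg_vec v \<and> (\<Sum>i\<in>UNIV. v $ i) = 1"

text \<open>The entry of the tensor \<open>P\<close> with indices \<open>(i, j, k)\<close> is \<open>P $ i $ j $ k\<close>.\<close>

definition transition_tensor :: "real ^ 'n ^ 'n ^ 'n \<Rightarrow> bool" where
  "transition_tensor P \<longleftrightarrow>
     (\<forall>i j k. 0 \<le> P $ i $ j $ k) \<and> (\<forall>j k. (\<Sum>i\<in>UNIV. P $ i $ j $ k) = 1)"

definition tensor_slice :: "real ^ 'n ^ 'n ^ 'n \<Rightarrow> 'n \<Rightarrow> real ^ 'n ^ 'n" where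
  "tensor_slice P j = (\<chi> i k. P $ i $ j $ k)"

definition from_columns :: "('n \<Rightarrow> real ^ 'n) \<Rightarrow> real ^ 'n ^ 'n" where
  "from_columns c = (\<chi> i j. c j $ i)"

definition G_mat :: "real ^ 'n \<Rightarrow> real ^ 'n ^ 'n" where
  "G_mat v = (1 / real CARD('n)) *\<^sub>R (\<chi> i j. v $ i * ones $ j)"

definition P_op :: "real ^ 'n ^ 'n ^ 'n \<Rightarrow> real ^ 'n ^ 'n \<Rightarrow> real ^ 'n ^ 'n" where
  "P_op P A = from_columns (\<lambda>j. tensor_slice P j *v row j A)"

definition T_obj :: "real \<Rightarrow> real ^ 'n \<Rightarrow> (real ^ 'n) \<times> real \<Rightarrow> real" where
  "T_obj \<beta> b = (\<lambda>(s, \<mu>).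
     1 / 2 * (norm (s + \<mu> *\<^sub>R ones - b))\<^sup>2 + \<beta> * (\<Sum>i\<in>UNIV. \<bar>s $ i\<bar>))"

definition T_feasible :: "(real ^ 'n) \<times> real \<Rightarrow> bool" where
  "T_feasible = (\<lambda>(s, \<mu>). nonneg_vec s \<and> 0 \<le> \<mu>)"

text \<open>As functions on the whole type, \<open>T_op\<close>, \<open>T_mat\<close> and \<open>H_op\<close> also take
  arguments with negative entries; only their values on nonnegative arguments are meant.\<close>

definition T_op :: "real \<Rightarrow> real ^ 'n \<Rightarrow> real ^ 'n" where
  "T_op \<beta> b =
     (let (s, \<mu>) = (THE p. is_arg_min (T_obj \<beta> b) T_feasible p) in s + \<mu> *\<^sub>R ones)"

definition T_mat :: "real \<Rightarrow> real ^ 'n ^ 'n \<Rightarrow> real ^ 'n ^ 'n" where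
  "T_mat \<beta> A = from_columns (\<lambda>j. T_op \<beta> (column j A))"

definition G_op :: "real ^ 'n ^ 'n ^ 'n \<Rightarrow> real ^ 'n \<Rightarrow> real \<Rightarrow> real ^ 'n ^ 'n \<Rightarrow> real ^ 'n ^ 'n" where
  "G_op P v \<alpha> A =
     from_columns (\<lambda>j. \<alpha> *\<^sub>R column j (P_op P A) + (1 - \<alpha>) *\<^sub>R column j (G_mat v))"

definition H_op ::
    "real ^ 'n ^ 'n ^ 'n \<Rightarrow> real ^ 'n \<Rightarrow> real \<Rightarrow> real \<Rightarrow> real ^ 'n ^ 'n \<Rightarrow> real ^ 'n ^ 'n" where
  "H_op P v \<alpha> \<beta> A = T_mat \<beta> (G_op P v \<alpha> A)"

end

theory Submission
  imports Defs
begin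

text \<open>Solving the optimality conditions gives \<open>T b = max (b - \<beta>) \<mu>\<close> entrywise, where \<open>\<mu> \<ge> 0\<close> is chosen
  such that \<open>T b\<close> and \<open>b\<close> have the same sum of entries. Hence \<open>T\<close> preserves both the order and the
  sum of entries, so by the argument of Crandall and Tartar it is nonexpansive in the entrywise
  \<open>\<ell>\<^sub>1\<close> norm. Since the matrices \<open>P\<^sub>j\<close> are column stochastic, \<open>P_op\<close> is nonexpansive in that norm
  too, so \<open>H_op\<close> contracts it by the factor \<open>\<alpha>\<close>, and the contraction principle applies.\<close>

definition l1_vec :: "real ^ 'n \<Rightarrow> real" where
  "l1_vec x = (\<Sum>i\<in>UNIV. \<bar>x $ i\<bar>)"

text \<open>The columns are summed, not maximized as in the induced operator norm: only then is the
  value the same whether entries are grouped by rows or by columns, as \<open>P_op\<close>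
  requires.\<close>

definition l1_mat :: "real ^ 'n ^ 'n \<Rightarrow> real" where
  "l1_mat A = (\<Sum>j\<in>UNIV. l1_vec (column j A))"

section \<open>Closed form of the minimizer\<close>

text \<open>Intermediate value theorem in \<mu>: at 0 each summand is at most \<open>b $ i\<close>,
  and at the total mass of \<open>b\<close> each is at least \<open>b $ i\<close>.\<close>

lemma exists_threshold:
  fixes b :: "real ^ 'n"
  assumes "nonneg_vec b" and "0 < \<beta>"
  obtains \<mu> where "0 \<le> \<mu>" and "(\<Sum>i\<in>UNIV. max (b $ i - \<beta>) \<mu>) = (\<Sum>i\<in>UNIV. b $ i)"
proof -
  let ?\<phi> = "\<lambda>\<mu>. \<Sum>i\<in>UNIV. max (b $ i - \<beta>) \<mu>"
  let ?m = "\<Sum>i\<in>UNIV. b $ i"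
  have b: "0 \<le> b $ i" for i
    using assms by (simp add: nonneg_vec_def)
  have "b $ i \<le> ?m" for i
    using b by (intro member_le_sum) auto
  then have "?m \<le> ?\<phi> ?m"
    by (intro sum_mono) (simp add: le_max_iff_disj)
  moreover have "?\<phi> 0 \<le> ?m"
    using b assms by (intro sum_mono) simp
  moreover have "0 \<le> ?m"
    using b by (simp add: sum_nonneg)
  moreover have "continuous_on {0..?m} ?\<phi>"
    by (intro continuous_intros)
  ultimately obtain \<mu> where "0 \<le> \<mu>" "?\<phi> \<mu> = ?m"
    using IVT'[of ?\<phi> 0 ?m ?m] by blast
  with that show thesis by blast
qed

text \<open>Optimality of the threshold point together with quadratic growth, which later yields
  uniqueness. Expanding the objective about \<open>x\<close> leaves two first-order terms: the one
  in \<open>\<nu> - \<mu>\<close> vanishes because \<open>x\<close> and \<open>b\<close> have equal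
  mass, the one in \<open>s\<close> is nonnegative.\<close>

lemma T_obj_threshold_gap:
  fixes b s :: "real ^ 'n"
  assumes "0 < \<beta>" and "nonneg_vec s"
    and mass: "(\<Sum>i\<in>UNIV. max (b $ i - \<beta>) \<mu>) = (\<Sum>i\<in>UNIV. b $ i)"
  defines "x \<equiv> \<chi> i. max (b $ i - \<beta>) \<mu>"
  shows "T_obj \<beta> b (x - \<mu> *\<^sub>R ones, \<mu>) + 1 / 2 * (norm (s + \<nu> *\<^sub>R ones - x))\<^sup>2 \<le> T_obj \<beta> b (s, \<nu>)"
proof -
  have sq: "(norm y)\<^sup>2 = (\<Sum>i\<in>UNIV. (y $ i)\<^sup>2)" for y :: "real ^ 'n"
    unfolding power2_norm_eq_inner inner_vec_def by (simp add: power2_eq_square)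
  have s: "0 \<le> s $ i" for i
    using assms by (simp add: nonneg_vec_def)
  have balance: "(\<Sum>i\<in>UNIV. (\<nu> - \<mu>) * (x $ i - b $ i)) = 0"
    using mass by (simp add: x_def sum_subtractf flip: sum_distrib_left)
  \<comment> \<open>Complementary slackness: either \<open>x $ i = \<mu>\<close> and both factors
    are nonnegative, or \<open>x $ i = b $ i - \<beta>\<close> and the second factor is
    zero.\<close>
  have "0 \<le> (\<Sum>i\<in>UNIV. (s $ i - (x $ i - \<mu>)) * (x $ i - b $ i + \<beta>))"
  proof (rule sum_nonneg)
    fix i
    show "0 \<le> (s $ i - (x $ i - \<mu>)) * (x $ i - b $ i + \<beta>)"
      using s[of i] by (simp add: x_def max_def)
  qed
  also have "\<dots> = (\<Sum>i\<in>UNIV. (1 / 2 * (s $ i + \<nu> - b $ i)\<^sup>2 + \<beta> * s $ i)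
      - (1 / 2 * (x $ i - b $ i)\<^sup>2 + \<beta> * (x $ i - \<mu>))
      - 1 / 2 * (s $ i + \<nu> - x $ i)\<^sup>2 - (\<nu> - \<mu>) * (x $ i - b $ i))"
    by (intro sum.cong refl) (simp add: power2_eq_square field_simps)
  also have "\<dots> = T_obj \<beta> b (s, \<nu>) - T_obj \<beta> b (x - \<mu> *\<^sub>R ones, \<mu>)
      - 1 / 2 * (norm (s + \<nu> *\<^sub>R ones - x))\<^sup>2 - 0"
  proof -
    have "\<bar>x $ i - \<mu>\<bar> = x $ i - \<mu>" for i
      by (simp add: x_def)
    then show ?thesis
      unfolding sum_subtractf balance T_obj_def sq
      using s by (simp add: ones_def sum.distrib sum_distrib_left)
  qed
  finally show ?thesis by simp
qed

lemma T_op_eq_threshold: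
  fixes b :: "real ^ 'n"
  assumes "0 < \<beta>" and "0 \<le> \<mu>"
    and mass: "(\<Sum>i\<in>UNIV. max (b $ i - \<beta>) \<mu>) = (\<Sum>i\<in>UNIV. b $ i)"
  shows "T_op \<beta> b = (\<chi> i. max (b $ i - \<beta>) \<mu>)"
proof -
  define x :: "real ^ 'n" where "x = (\<chi> i. max (b $ i - \<beta>) \<mu>)"
  define p where "p = (x - \<mu> *\<^sub>R ones, \<mu>)"
  have gap: "T_obj \<beta> b p + 1 / 2 * (norm (s + \<nu> *\<^sub>R ones - x))\<^sup>2 \<le> T_obj \<beta> b (s, \<nu>)"
    if "nonneg_vec s" for s \<nu>
    unfolding p_def x_def by (rule T_obj_threshold_gap[OF assms(1) that mass])
  have feas: "T_feasible p"
    using assms by (simp add: T_feasible_def p_def nonneg_vec_def x_def ones_def)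
  have min: "is_arg_min (T_obj \<beta> b) T_feasible p"
    unfolding is_arg_min_def
  proof (intro conjI feas notI, elim exE conjE)
    fix q assume "T_feasible q" and less: "T_obj \<beta> b q < T_obj \<beta> b p"
    moreover obtain s \<nu> where q: "q = (s, \<nu>)" by (cases q)
    ultimately have "nonneg_vec s"
      by (simp add: T_feasible_def)
    from gap[OF this, of \<nu>] have "T_obj \<beta> b p \<le> T_obj \<beta> b q"
      using zero_le_power2[of "norm (s + \<nu> *\<^sub>R ones - x)"] unfolding q by linarith
    with less show False by simp
  qed
  moreover have "q = p" if "is_arg_min (T_obj \<beta> b) T_feasible q" for q
  proof -
    obtain s \<nu> where q: "q = (s, \<nu>)" by (cases q)
    have s: "nonneg_vec s"
      using that by (simp add: is_arg_min_def T_feasible_def q)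
    have eq: "T_obj \<beta> b q = T_obj \<beta> b p"
      using that min unfolding is_arg_min_def by (meson linorder_neqE)
    with gap[OF s, of \<nu>] have "(norm (s + \<nu> *\<^sub>R ones - x))\<^sup>2 \<le> 0"
      by (simp add: q)
    then have x: "x = s + \<nu> *\<^sub>R ones"
      by simp
    \<comment> \<open>The gap determines only \<open>s + \<nu> *\<^sub>R ones\<close>. With equal
      residuals, equal objectives force equal penalties since \<beta> is positive; this fixes how
      the sum splits.\<close>
    have "(\<Sum>i\<in>UNIV. \<bar>s $ i\<bar>) = (\<Sum>i\<in>UNIV. \<bar>(x - \<mu> *\<^sub>R ones) $ i\<bar>)"
      using eq assms(1) by (simp add: q p_def T_obj_def x)
    moreover have "\<bar>(x - \<mu> *\<^sub>R ones) $ i\<bar> = (x - \<mu> *\<^sub>R ones) $ i" for i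
      by (simp add: x_def ones_def)
    moreover have "\<bar>s $ i\<bar> = s $ i" for i
      using s by (simp add: nonneg_vec_def)
    ultimately have "(\<Sum>i\<in>UNIV. s $ i) = (\<Sum>i\<in>UNIV. (x - \<mu> *\<^sub>R ones) $ i)"
      by (simp only:)
    also have "\<dots> = (\<Sum>i\<in>UNIV. s $ i + (\<nu> - \<mu>))"
      by (simp add: x ones_def algebra_simps)
    finally have "(\<Sum>i\<in>UNIV. s $ i) = (\<Sum>i\<in>UNIV. s $ i + (\<nu> - \<mu>))" .
    then have "\<nu> = \<mu>"
      by (simp add: sum.distrib)
    then show "q = p"
      by (simp add: q p_def x)
  qed
  ultimately have "(THE q. is_arg_min (T_obj \<beta> b) T_feasible q) = p"
    by (rule the_equality)
  then show ?thesis
    by (simp add: T_op_def p_def x_def)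
qed

lemma T_op_threshold:
  fixes b :: "real ^ 'n"
  assumes "nonneg_vec b" and "0 < \<beta>"
  obtains \<mu> where "0 \<le> \<mu>" and "\<And>i. T_op \<beta> b $ i = max (b $ i - \<beta>) \<mu>"
    and "(\<Sum>i\<in>UNIV. max (b $ i - \<beta>) \<mu>) = (\<Sum>i\<in>UNIV. b $ i)"
proof -
  obtain \<mu> where \<mu>: "0 \<le> \<mu>" "(\<Sum>i\<in>UNIV. max (b $ i - \<beta>) \<mu>) = (\<Sum>i\<in>UNIV. b $ i)"
    using exists_threshold[OF assms] .
  show thesis
    by (rule that[OF \<mu>(1) _ \<mu>(2)]) (simp add: T_op_eq_threshold[OF assms(2) \<mu>])
qed

section \<open>Order, mass and nonexpansiveness of \<open>T_op\<close>\<close>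

lemma T_op_nonneg:
  assumes "nonneg_vec b" and "0 < \<beta>"
  shows "nonneg_vec (T_op \<beta> b)"
  by (rule T_op_threshold[OF assms]) (simp add: nonneg_vec_def le_max_iff_disj)

lemma sum_T_op:
  assumes "nonneg_vec b" and "0 < \<beta>"
  shows "(\<Sum>i\<in>UNIV. T_op \<beta> b $ i) = (\<Sum>i\<in>UNIV. b $ i)"
  by (rule T_op_threshold[OF assms]) simp

lemma T_op_mono:
  fixes b c :: "real ^ 'n"
  assumes "nonneg_vec b" and "nonneg_vec c" and "0 < \<beta>" and le: "\<And>i. b $ i \<le> c $ i"
  shows "T_op \<beta> b $ i \<le> T_op \<beta> c $ i"
proof -
  obtain \<mu> where "0 \<le> \<mu>" and \<mu>: "\<And>i. T_op \<beta> b $ i = max (b $ i - \<beta>) \<mu>"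
    "(\<Sum>i\<in>UNIV. max (b $ i - \<beta>) \<mu>) = (\<Sum>i\<in>UNIV. b $ i)"
    by (rule T_op_threshold[OF assms(1,3)]) (rule that)
  obtain \<nu> where "0 \<le> \<nu>" and \<nu>: "\<And>i. T_op \<beta> c $ i = max (c $ i - \<beta>) \<nu>"
    "(\<Sum>i\<in>UNIV. max (c $ i - \<beta>) \<nu>) = (\<Sum>i\<in>UNIV. c $ i)"
    by (rule T_op_threshold[OF assms(2,3)]) (rule that)
  have "max (b $ i - \<beta>) \<mu> \<le> max (c $ i - \<beta>) \<nu>"
  proof (cases "\<mu> \<le> \<nu>")
    case True
    then show ?thesis
      using le[of i] by (intro max.mono) auto
  next
    case False
    \<comment> \<open>The change made by the threshold,
      \<open>max (- \<beta>) (\<mu> - b $ j)\<close>, increases with \<mu> and decreases with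
      \<open>b $ j\<close>. Both changes sum to zero, so the inequality is an equality in every
      entry.\<close>
    have le': "max (c $ j - \<beta>) \<nu> - c $ j \<le> max (b $ j - \<beta>) \<mu> - b $ j" for j
      using False le[of j] by (simp add: max_def)
    have "(\<Sum>j\<in>UNIV. max (c $ j - \<beta>) \<nu> - c $ j) = (\<Sum>j\<in>UNIV. max (b $ j - \<beta>) \<mu> - b $ j)"
      using \<mu> \<nu> by (simp add: sum_subtractf)
    from sum_mono_inv[OF this le'] have "max (c $ i - \<beta>) \<nu> - c $ i = max (b $ i - \<beta>) \<mu> - b $ i"
      by simp
    then show ?thesis
      using le[of i] by linarith
  qed
  then show ?thesis
    by (simp only: \<mu>(1) \<nu>(1))
qed

text \<open>The entrywise maximum \<open>d\<close> dominates \<open>b\<close> and \<open>c\<close>,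
  so by monotonicity the difference of the images is bounded by two nonnegative gaps to the image of
  \<open>d\<close>. Mass preservation turns their sum into that of \<open>2 * d - b - c\<close>,
  which is the entrywise distance of \<open>b\<close> and \<open>c\<close>.\<close>

lemma T_op_nonexpansive:
  fixes b c :: "real ^ 'n"
  assumes b: "nonneg_vec b" and c: "nonneg_vec c" and \<beta>: "0 < \<beta>"
  shows "l1_vec (T_op \<beta> b - T_op \<beta> c) \<le> l1_vec (b - c)"
proof -
  define d :: "real ^ 'n" where "d = (\<chi> i. max (b $ i) (c $ i))"
  have d: "nonneg_vec d"
    using b by (simp add: d_def nonneg_vec_def le_max_iff_disj)
  have "\<bar>T_op \<beta> b $ i - T_op \<beta> c $ i\<bar> \<le> 2 * T_op \<beta> d $ i - T_op \<beta> b $ i - T_op \<beta> c $ i" for i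
    using T_op_mono[OF b d \<beta>, of i] T_op_mono[OF c d \<beta>, of i] by (simp add: d_def)
  then have "l1_vec (T_op \<beta> b - T_op \<beta> c)
      \<le> (\<Sum>i\<in>UNIV. 2 * T_op \<beta> d $ i - T_op \<beta> b $ i - T_op \<beta> c $ i)"
    unfolding l1_vec_def by (intro sum_mono) simp
  also have "\<dots> = (\<Sum>i\<in>UNIV. 2 * d $ i - b $ i - c $ i)"
    by (simp add: sum_subtractf sum_T_op b c d \<beta> flip: sum_distrib_left)
  also have "\<dots> = l1_vec (b - c)"
    unfolding l1_vec_def by (intro sum.cong refl) (simp add: d_def max_def)
  finally show ?thesis .
qed

section \<open>Entrywise norm estimates and the contraction factor\<close>

lemma l1_vec_scaleR: "l1_vec (a *\<^sub>R x) = \<bar>a\<bar> * l1_vec x"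
  by (simp add: l1_vec_def abs_mult sum_distrib_left)

lemma l1_mat_entries: "l1_mat A = (\<Sum>i\<in>UNIV. \<Sum>j\<in>UNIV. \<bar>A $ i $ j\<bar>)"
  unfolding l1_mat_def l1_vec_def by (subst sum.swap) (simp add: column_def)

text \<open>Links the two norms in play: contraction is measured by \<open>l1_mat\<close>,
  convergence by \<open>norm\<close>.\<close>

lemma norm_le_l1_mat: "norm A \<le> l1_mat A"
proof -
  have "norm A \<le> (\<Sum>i\<in>UNIV. norm (A $ i))"
    by (simp add: norm_vec_def L2_set_le_sum)
  also have "\<dots> \<le> l1_mat A"
    unfolding l1_mat_entries by (intro sum_mono norm_le_l1_cart)
  finally show ?thesis .
qed

lemma column_from_columns [simp]: "column j (from_columns c) = c j"
  by (simp add: column_def from_columns_def vec_eq_iff)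

lemma nonneg_mat_columns: "nonneg_mat A \<longleftrightarrow> (\<forall>j. nonneg_vec (column j A))"
  by (auto simp: nonneg_mat_def nonneg_vec_def column_def)

lemma column_diff: "column j (A - B) = column j A - column j B"
  by (simp add: column_def vec_eq_iff)

lemma l1_vec_stochastic_mult:
  fixes M :: "real ^ 'n ^ 'n"
  assumes nn: "\<And>i k. 0 \<le> M $ i $ k" and col: "\<And>k. (\<Sum>i\<in>UNIV. M $ i $ k) = 1"
  shows "l1_vec (M *v x) \<le> l1_vec x"
proof -
  have "l1_vec (M *v x) \<le> (\<Sum>i\<in>UNIV. \<Sum>k\<in>UNIV. M $ i $ k * \<bar>x $ k\<bar>)"
    unfolding l1_vec_def matrix_vector_mult_def
    using nn by (intro sum_mono) (simp add: order.trans[OF sum_abs] abs_mult)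
  also have "\<dots> = l1_vec x"
    unfolding l1_vec_def by (subst sum.swap) (simp add: col flip: sum_distrib_right)
  finally show ?thesis .
qed

text \<open>Column \<open>j\<close> of the image is a column stochastic matrix applied to row
  \<open>j\<close>, so its norm is at most that of the row; the row norms add up to
  \<open>l1_mat\<close>.\<close>

lemma P_op_nonexpansive:
  assumes "transition_tensor P"
  shows "l1_mat (P_op P A - P_op P B) \<le> l1_mat (A - B)"
proof -
  have "l1_mat (P_op P A - P_op P B) = (\<Sum>j\<in>UNIV. l1_vec (tensor_slice P j *v row j (A - B)))"
  proof -
    have "row j (A - B) = row j A - row j B" for j
      by (simp add: row_def vec_eq_iff)
    then show ?thesis
      by (simp add: l1_mat_def column_diff P_op_def matrix_vector_mult_diff_distrib)
  qed
  also have "\<dots> \<le> (\<Sum>j\<in>UNIV. l1_vec (row j (A - B)))"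
    using assms
    by (intro sum_mono l1_vec_stochastic_mult) (auto simp: transition_tensor_def tensor_slice_def)
  also have "\<dots> = l1_mat (A - B)"
    by (simp add: l1_mat_entries l1_vec_def row_def)
  finally show ?thesis .
qed

text \<open>The \<open>G_mat\<close> term is constant and cancels in the difference.\<close>

lemma G_op_contraction:
  assumes "transition_tensor P" and "0 < \<alpha>"
  shows "l1_mat (G_op P v \<alpha> A - G_op P v \<alpha> B) \<le> \<alpha> * l1_mat (A - B)"
proof -
  have "l1_mat (G_op P v \<alpha> A - G_op P v \<alpha> B) = \<alpha> * l1_mat (P_op P A - P_op P B)"
    using assms(2)
    by (simp add: l1_mat_def G_op_def column_diff l1_vec_scaleR sum_distrib_left
        flip: scaleR_diff_right)
  then show ?thesis
    using P_op_nonexpansive[OF assms(1)] assms(2) by simp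
qed

lemma G_op_nonneg:
  assumes "transition_tensor P" and "stochastic_vec v" and "0 < \<alpha>" and "\<alpha> < 1" and "nonneg_mat A"
  shows "nonneg_mat (G_op P v \<alpha> A)"
  using assms
  by (simp add: nonneg_mat_def G_op_def from_columns_def column_def P_op_def G_mat_def ones_def
      tensor_slice_def row_def matrix_vector_mult_def transition_tensor_def stochastic_vec_def
      nonneg_vec_def sum_nonneg)

lemma H_op_nonneg:
  assumes "transition_tensor P" and "stochastic_vec v" and "0 < \<alpha>" and "\<alpha> < 1" and "0 < \<beta>"
    and "nonneg_mat A"
  shows "nonneg_mat (H_op P v \<alpha> \<beta> A)"
  using G_op_nonneg[of P v \<alpha> A] assms
  by (simp add: H_op_def T_mat_def nonneg_mat_columns T_op_nonneg)

lemma H_op_contraction: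
  assumes "transition_tensor P" and "stochastic_vec v" and "0 < \<alpha>" and "\<alpha> < 1" and "0 < \<beta>"
    and "nonneg_mat A" and "nonneg_mat B"
  shows "l1_mat (H_op P v \<alpha> \<beta> A - H_op P v \<alpha> \<beta> B) \<le> \<alpha> * l1_mat (A - B)"
proof -
  have "l1_mat (H_op P v \<alpha> \<beta> A - H_op P v \<alpha> \<beta> B) \<le> l1_mat (G_op P v \<alpha> A - G_op P v \<alpha> B)"
    using G_op_nonneg[OF assms(1-4)] assms(5-7)
    by (simp add: l1_mat_def H_op_def T_mat_def column_diff nonneg_mat_columns sum_mono
        T_op_nonexpansive)
  also have "\<dots> \<le> \<alpha> * l1_mat (A - B)"
    by (rule G_op_contraction[OF assms(1,3)])
  finally show ?thesis .
qed

section \<open>Contraction principle on a closed set\<close>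

lemma closed_nonneg_mat: "closed {A. nonneg_mat A}"
  unfolding nonneg_mat_def by (intro closed_Collect_all closed_Collect_le continuous_intros)

lemma l1_mat_contraction_principle:
  fixes f :: "real ^ 'n ^ 'n \<Rightarrow> real ^ 'n ^ 'n"
  assumes "closed S" and "S \<noteq> {}" and "0 \<le> a" and "a < 1"
    and self: "\<And>A. A \<in> S \<Longrightarrow> f A \<in> S"
    and contr: "\<And>A B. A \<in> S \<Longrightarrow> B \<in> S \<Longrightarrow> l1_mat (f A - f B) \<le> a * l1_mat (A - B)"
  shows "\<exists>Z\<in>S. f Z = Z \<and> (\<forall>Y\<in>S. f Y = Y \<longrightarrow> Y = Z) \<and>
    (\<forall>X. X 0 \<in> S \<and> (\<forall>q. X (Suc q) = f (X q)) \<longrightarrow> X \<longlonglongrightarrow> Z)"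
proof -
  \<comment> \<open>Stated for two arbitrary orbits to serve twice: an orbit against its own shift
    gives existence of a limit, an orbit against the constant one at \<open>Z\<close> gives
    convergence.\<close>
  have decay: "l1_mat (X q - Y q) \<le> a ^ q * l1_mat (X 0 - Y 0)"
    if "\<And>q. X q \<in> S" "\<And>q. Y q \<in> S" "\<And>q. X (Suc q) = f (X q)" "\<And>q. Y (Suc q) = f (Y q)" for X Y q
  proof (induction q)
    case (Suc q)
    have "l1_mat (X (Suc q) - Y (Suc q)) \<le> a * l1_mat (X q - Y q)"
      using contr[OF that(1)[of q] that(2)[of q]] by (simp add: that)
    also have "\<dots> \<le> a * (a ^ q * l1_mat (X 0 - Y 0))"
      by (intro mult_left_mono Suc.IH assms(3))
    finally show ?case by (simp add: mult.assoc)
  qed simp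
  have orbit: "X q \<in> S" if "X 0 \<in> S" "\<And>q. X (Suc q) = f (X q)" for X q
    by (induction q) (simp_all add: that self)
  obtain A where "A \<in> S"
    using assms(2) by blast
  define X where "X q = (f ^^ q) A" for q
  have X_Suc: "X (Suc q) = f (X q)" for q
    by (simp add: X_def)
  have X_in: "X q \<in> S" for q
    by (rule orbit[of X, OF _ X_Suc]) (simp add: X_def \<open>A \<in> S\<close>)
  \<comment> \<open>The increments are dominated by a geometric series, so the telescoping sum
    converges, and with it the orbit.\<close>
  have "summable (\<lambda>q. X (Suc q) - X q)"
  proof (rule summable_comparison_test')
    show "summable (\<lambda>q. a ^ q * l1_mat (X 1 - X 0))"
      using assms(3,4) by (intro summable_mult2 summable_geometric) simp
    show "norm (X (Suc q) - X q) \<le> a ^ q * l1_mat (X 1 - X 0)" for q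
      using order.trans[OF norm_le_l1_mat decay[of "\<lambda>q. X (Suc q)" X q, OF X_in X_in X_Suc X_Suc]]
      by simp
  qed
  from summable_LIMSEQ[OF this] have "(\<lambda>n. X n - X 0) \<longlonglongrightarrow> (\<Sum>q. X (Suc q) - X q)"
    by (simp only: sum_lessThan_telescope)
  from tendsto_add[OF this tendsto_const[of "X 0"]] obtain Z where lim: "X \<longlonglongrightarrow> Z"
    by simp
  have Z_in: "Z \<in> S"
    by (rule closed_sequentially[OF assms(1) X_in lim])
  \<comment> \<open>Back from \<open>norm\<close> to \<open>l1_mat\<close>, by continuity, because
    \<open>contr\<close> is needed at the limit \<open>Z\<close>.\<close>
  have l1_tendsto_0: "(\<lambda>q. l1_mat (Z - X q)) \<longlonglongrightarrow> 0"
  proof -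
    have "(\<lambda>q. l1_mat (Z - X q)) \<longlonglongrightarrow> l1_mat (Z - Z)"
      unfolding l1_mat_entries by (intro tendsto_intros lim)
    then show ?thesis by (simp add: l1_mat_entries)
  qed
  have fixed: "f Z = Z"
  proof -
    have "(\<lambda>q. f (X q)) \<longlonglongrightarrow> f Z"
    proof (rule Lim_transform2)
      show "(\<lambda>q. f Z) \<longlonglongrightarrow> f Z" by simp
      show "(\<lambda>q. f Z - f (X q)) \<longlonglongrightarrow> 0"
      proof (rule Lim_null_comparison)
        show "\<forall>\<^sub>F q in sequentially. norm (f Z - f (X q)) \<le> a * l1_mat (Z - X q)"
          by (intro always_eventually allI order.trans[OF norm_le_l1_mat contr[OF Z_in X_in]])
        show "(\<lambda>q. a * l1_mat (Z - X q)) \<longlonglongrightarrow> 0"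
          using tendsto_mult_left[OF l1_tendsto_0, of a] by simp
      qed
    qed
    moreover have "(\<lambda>q. f (X q)) \<longlonglongrightarrow> Z"
      using LIMSEQ_Suc[OF lim] by (simp add: X_Suc)
    ultimately show ?thesis by (rule LIMSEQ_unique)
  qed
  have conv: "Y \<longlonglongrightarrow> Z" if "Y 0 \<in> S" "\<And>q. Y (Suc q) = f (Y q)" for Y
  proof -
    have bound: "norm (Y q - Z) \<le> a ^ q * l1_mat (Y 0 - Z)" for q
      by (rule order.trans[OF norm_le_l1_mat decay[of Y "\<lambda>_. Z"]])
        (simp_all add: orbit[of Y, OF that] Z_in fixed that(2))
    have "(\<lambda>q. a ^ q * l1_mat (Y 0 - Z)) \<longlonglongrightarrow> 0"
      using assms(3,4) by (intro tendsto_mult_left_zero LIMSEQ_realpow_zero)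
    then have "(\<lambda>q. Y q - Z) \<longlonglongrightarrow> 0"
      by (rule Lim_null_comparison[OF always_eventually, rotated]) (simp add: bound)
    then show ?thesis by (rule LIM_zero_cancel)
  qed
  \<comment> \<open>A fixed point is a constant orbit, and every orbit in \<open>S\<close> tends to
    \<open>Z\<close>.\<close>
  have "Y = Z" if "Y \<in> S" "f Y = Y" for Y
    using conv[of "\<lambda>_. Y", OF that(1) that(2)[symmetric]] by (simp add: LIMSEQ_const_iff)
  with Z_in fixed conv show ?thesis by blast
qed

theorem theorem4p3:
  fixes P :: "real ^ 'n ^ 'n ^ 'n" and v :: "real ^ 'n" and \<alpha> \<beta> :: real
  assumes "transition_tensor P"
    and "stochastic_vec v"
    and "0 < \<beta>"
    and "0 < \<alpha>" and "\<alpha> < 1"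
  shows "\<exists>Z. nonneg_mat Z \<and> H_op P v \<alpha> \<beta> Z = Z
           \<and> (\<forall>Y. nonneg_mat Y \<and> H_op P v \<alpha> \<beta> Y = Y \<longrightarrow> Y = Z)
           \<and> (\<forall>X :: nat \<Rightarrow> real ^ 'n ^ 'n.
                 nonneg_mat (X 0) \<and> (\<forall>q. X (Suc q) = H_op P v \<alpha> \<beta> (X q))
                 \<longrightarrow> X \<longlonglongrightarrow> Z)"
proof -
  let ?H = "H_op P v \<alpha> \<beta>" and ?S = "{A :: real ^ 'n ^ 'n. nonneg_mat A}"
  have "nonneg_mat (0 :: real ^ 'n ^ 'n)"
    by (simp add: nonneg_mat_def)
  then have ne: "?S \<noteq> {}" by blast
  have self: "?H A \<in> ?S" if "A \<in> ?S" for A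
    using that H_op_nonneg[OF assms(1,2,4,5,3)] by simp
  have contr: "l1_mat (?H A - ?H B) \<le> \<alpha> * l1_mat (A - B)" if "A \<in> ?S" "B \<in> ?S" for A B
    using that H_op_contraction[OF assms(1,2,4,5,3)] by simp
  show ?thesis
    using l1_mat_contraction_principle
        [OF closed_nonneg_mat ne less_imp_le[OF assms(4)] assms(5) self contr]
    by auto
qed

end
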